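(* Let $q$ be an odd prime power and $n\ge2$ with $(q^n-1)/2$ even. Let $\beta\in\mathbb{F}_q^*$, let $m$ be an even divisor of $q^n-1$, let $Q=(q^n-1)/(q-1)$, and let $m_Q$ be the product of those primes dividing $m$ that also divide $Q$. Then $$\mathcal{N}_\beta(m)\ \ge\ \theta(m)\,q^{\frac{n-1}{2}}\Big\{q^{\frac{n-1}{2}}-4W(m)+2W(m_Q)+1\Big\}.$$
   Context: For a divisor $m$ of $q^n-1$, an element $\xi\in\mathbb{F}_{q^n}^*$ is $m$-free if $\xi=\zeta^d$ with $d\mid m$ and $\zeta\in\mathbb{F}_{q^n}^*$ implies $d=1$. For $\beta\in\mathbb{F}_q$, $\mathcal{N}_\beta(m)$ denotes the number of $m$-free $\xi\in\mathbb{F}_{q^n}^*$ with $\mathrm{Tr}(\xi^2)=\beta$, where $\mathrm{Tr}(\xi)=\sum_{i=0}^{n-1}\xi^{q^i}$. $\theta(m)=\phi(m)/m$ with $\phi$ Euler's function, and $W(t)$ is the number of square-free divisors of $t$. *)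

theory Defs
  imports
    Complex_Main
    "HOL-Library.Cardinality"
    "HOL-Computational_Algebra.Primes"
    "HOL-Computational_Algebra.Squarefree"
    "HOL-Number_Theory.Prime_Powers"
    "HOL-Number_Theory.Totient"
begin

definition is_subfield :: "'a::field set \<Rightarrow> bool" where
  "is_subfield K \<longleftrightarrow>
     0 \<in> K \<and> 1 \<in> K \<and>
     (\<forall>x\<in>K. \<forall>y\<in>K. x + y \<in> K \<and> x * y \<in> K) \<and>
     (\<forall>x\<in>K. - x \<in> K \<and> inverse x \<in> K)"

(* Trace of a field with q^n elements over its subfield with q elements. *)
definition field_trace :: "nat \<Rightarrow> nat \<Rightarrow> 'a::field \<Rightarrow> 'a" where
  "field_trace q n x = (\<Sum>i<n. x ^ (q ^ i))"

definition m_free :: "nat \<Rightarrow> 'a::field \<Rightarrow> bool" where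
  "m_free m \<xi> \<longleftrightarrow> (\<forall>d \<zeta>. d dvd m \<and> \<zeta> \<noteq> 0 \<and> \<xi> = \<zeta> ^ d \<longrightarrow> d = 1)"

definition N_count :: "nat \<Rightarrow> nat \<Rightarrow> 'a::field \<Rightarrow> nat \<Rightarrow> nat" where
  "N_count q n \<beta> m = card {\<xi>::'a. \<xi> \<noteq> 0 \<and> m_free m \<xi> \<and> field_trace q n (\<xi> ^ 2) = \<beta>}"

definition \<theta> :: "nat \<Rightarrow> real" where
  "\<theta> m = real (totient m) / real m"

definition W :: "nat \<Rightarrow> nat" where
  "W t = card {d. d dvd t \<and> squarefree d}"

end

theory Submission
  imports Defs "HOL-Algebra.Multiplicative_Group" "HOL-Computational_Algebra.Polynomial"
begin

text \<open>
  Fix a generator \<open>g\<close> of the multiplicative group, put \<open>N = q^n - 1\<close> and let \<open>chi k\<close> be the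
  character sending \<open>g\<close> to the \<open>k\<close>-th power of a primitive \<open>N\<close>-th root of unity. For nontrivial
  \<open>chi k\<close> let \<open>U b = trace_sum k b\<close> be the sum of \<open>chi k y\<close> over all \<open>y\<close> with trace \<open>b\<close>. Substituting \<open>y = z t\<close> and
  counting kernels of \<open>z \<mapsto> Tr (z (t - 1))\<close>, the sum of \<open>|U b|^2\<close> over \<open>b\<close> in \<open>K\<close> is
  \<open>q^n - q^(n-1)\<close>. Since \<open>|U b|\<close> is the same for all nonzero \<open>b\<close>, this gives \<open>|U b| \<le> q^((n-1)/2)\<close>
  without Gauss sums.

  The sum of \<open>chi k x\<close> over \<open>x\<close> with \<open>Tr (x^2) = b\<close> vanishes for odd \<open>k\<close>, as one sees from
  \<open>x \<mapsto> -x\<close>; for \<open>k = 2 l\<close> it is the sum of two sums \<open>U b\<close>, for \<open>chi l\<close> and for \<open>chi (l + N/2)\<close>.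
  Writing the indicator of ``not a \<open>p\<close>-th power'' as
  \<open>(1 - 1/p) (1 - 1/(p-1) \<Sum>\<close> nontrivial characters of order \<open>p)\<close> and removing the primes dividing \<open>m\<close>
  one at a time yields the lower bound with \<open>-2 W(m) + 1\<close> in the braces. This is at least the
  claimed bound, because \<open>W(m_Q) \<le> W(m)\<close>.
\<close>

section \<open>Characters of the multiplicative group\<close>

text \<open>The type is repackaged as a ring record so that the cyclicity of the multiplicative
  group of a finite field, known for such records, applies.\<close>

lemma finite_field_has_generator:
  "\<exists>g::'a::finite_field. g \<noteq> 0 \<and> (\<forall>x. x \<noteq> 0 \<longrightarrow> (\<exists>i::nat. x = g ^ i))"
proof -
  define R :: "'a ring"
    where "R = \<lparr>carrier = UNIV, monoid.mult = (*), one = 1, zero = 0, add = (+)\<rparr>"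
  interpret R: field R
  proof -
    have "\<exists>y. x + y = 0" for x :: 'a
      by (rule exI[of _ "- x"]) simp
    moreover have "\<exists>y. x * y = 1" if "x \<noteq> 0" for x :: 'a
      by (rule exI[of _ "inverse x"]) (simp add: that)
    ultimately show "field R"
      by unfold_locales (auto simp: R_def algebra_simps Units_def)
  qed
  have car: "carrier R = UNIV" and zero: "\<zero>\<^bsub>R\<^esub> = 0"
    by (simp_all add: R_def)
  have pow: "x [^]\<^bsub>R\<^esub> i = x ^ i" for x :: 'a and i :: nat
    by (induction i) (simp_all add: R_def nat_pow_def)
  obtain g where g: "g \<in> carrier (mult_of R)"
      "carrier (mult_of R) = {g [^]\<^bsub>R\<^esub> i | i::nat. i \<in> UNIV}"
    using R.finite_field_mult_group_has_gen car by auto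
  from g(2) have "UNIV - {0} = {g ^ i | i::nat. True}"
    by (simp add: carrier_mult_of car zero pow)
  then have "\<exists>i. x = g ^ i" if "x \<noteq> 0" for x
    using that by blast
  moreover have "g \<noteq> 0"
    using g(1) by (simp add: carrier_mult_of car zero)
  ultimately show ?thesis by blast
qed

lemma power_mod_exponent:
  fixes z :: "'a::monoid_mult"
  assumes "z ^ N = 1"
  shows "z ^ (i mod N) = z ^ i"
  by (metis assms mult_div_mod_eq power_add power_mult power_one mult_1)

locale field_generator =
  fixes g :: "'a::finite_field" and N :: nat
  assumes N_def: "N = CARD('a) - 1" 
    and g_nonzero [simp]: "g \<noteq> 0"
    and ex_power: "x \<noteq> 0 \<Longrightarrow> \<exists>i::nat. x = g ^ i"
begin

definition dlog :: "'a \<Rightarrow> nat" where "dlog x = (SOME i. x = g ^ i)"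

lemma power_dlog: "x \<noteq> 0 \<Longrightarrow> g ^ dlog x = x"
  unfolding dlog_def using someI_ex[OF ex_power] by metis

lemma N_pos: "N > 0"
proof -
  have "card {0, 1 :: 'a} \<le> CARD('a)" by (rule card_mono) auto
  then show ?thesis by (simp add: N_def)
qed

lemma power_N: "x \<noteq> 0 \<Longrightarrow> x ^ N = (1::'a)"
proof -
  assume "x \<noteq> 0"
  have "x * x ^ N = x ^ CARD('a)"
    by (simp add: N_def flip: power_Suc)
  then show "x ^ N = 1"
    using \<open>x \<noteq> 0\<close> by (simp add: finite_field_power_card_eq_same)
qed

lemma power_mod_N: "g ^ (i mod N) = g ^ i"
  by (simp add: power_mod_exponent power_N)

text \<open>Exponents below \<open>N\<close> already reach all \<open>N\<close> nonzero elements,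
  and a surjection between finite sets of equal size is injective.\<close>

lemma power_eq_iff: "g ^ i = g ^ j \<longleftrightarrow> i mod N = j mod N"
proof
  have "(\<lambda>i. g ^ i) ` {..<N} = UNIV - {0}"
  proof (intro equalityI subsetI)
    fix x :: 'a assume "x \<in> UNIV - {0}"
    then obtain i where "x = g ^ i" using ex_power by auto
    then have "x = g ^ (i mod N)" by (simp add: power_mod_N)
    then show "x \<in> (\<lambda>i. g ^ i) ` {..<N}" using N_pos by auto
  qed auto
  then have inj: "inj_on (\<lambda>i. g ^ i) {..<N}"
    by (intro eq_card_imp_inj_on) (simp_all add: card_Diff_subset N_def)
  assume "g ^ i = g ^ j"
  then have "g ^ (i mod N) = g ^ (j mod N)" by (simp add: power_mod_N)
  then show "i mod N = j mod N"
    by (rule inj_onD[OF inj]) (use N_pos in auto)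
qed (metis power_mod_N)

definition \<omega> :: complex where "\<omega> = cis (2 * pi / real N)"

lemma omega_power_eq_1_iff: "\<omega> ^ j = 1 \<longleftrightarrow> N dvd j"
proof -
  have pow: "\<omega> ^ j = cis (2 * pi * real j / real N)" for j
    by (simp add: \<omega>_def Complex.DeMoivre mult_ac)
  have N1: "\<omega> ^ N = 1" using N_pos by (simp add: pow)
  from N1 have "\<omega> ^ j = \<omega> ^ (j mod N)"
    by (simp add: power_mod_exponent)
  then have "\<omega> ^ j = 1 \<longleftrightarrow> cis (2 * pi * real (j mod N) / real N) = cis (2 * pi * real 0 / real N)"
    by (simp add: pow)
  also have "\<dots> \<longleftrightarrow> j mod N = 0"
    using inj_on_eq_iff[OF bij_betw_imp_inj_on[OF bij_betw_roots_unity[OF N_pos]], of "j mod N" 0] N_pos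
    by simp
  finally show ?thesis by (simp add: dvd_eq_mod_eq_0)
qed

lemma omega_power_cong: "i mod N = j mod N \<Longrightarrow> \<omega> ^ i = \<omega> ^ j"
  using power_mod_exponent[of \<omega> N i] power_mod_exponent[of \<omega> N j]
  by (simp add: omega_power_eq_1_iff)

lemma norm_omega [simp]: "norm \<omega> = 1"
  by (simp add: \<omega>_def)

text \<open>At 0 the value is an unspecified root of unity rather than 0, so the sums over trace
  conditions exclude 0 explicitly.\<close>

definition chi :: "nat \<Rightarrow> 'a \<Rightarrow> complex" where "chi k x = \<omega> ^ (k * dlog x)"

lemma chi_power: "chi k (g ^ i) = \<omega> ^ (k * i)"
proof -
  have "dlog (g ^ i) mod N = i mod N"
    using power_dlog[of "g ^ i"] by (simp add: power_eq_iff)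
  then show ?thesis
    unfolding chi_def by (intro omega_power_cong) (metis mod_mult_right_eq)
qed

lemma norm_chi [simp]: "norm (chi k x) = 1"
  by (simp add: chi_def norm_power)

lemma chi_mult: "x \<noteq> 0 \<Longrightarrow> y \<noteq> 0 \<Longrightarrow> chi k (x * y) = chi k x * chi k y"
  using power_dlog[of x] power_dlog[of y]
  by (metis chi_power distrib_left power_add)

lemma chi_add: "chi (k + l) x = chi k x * chi l x"
  by (simp add: chi_def distrib_right power_add)

lemma chi_0 [simp]: "chi 0 x = 1"
  by (simp add: chi_def)

lemma chi_mult_left: "chi (a * k) x = chi k x ^ a"
  by (simp add: chi_def power_mult [symmetric] mult_ac)

lemma chi_square: "x \<noteq> 0 \<Longrightarrow> chi l (x\<^sup>2) = chi (2 * l) x"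
  by (simp add: chi_mult_left power2_eq_square chi_mult)

text \<open>Multiplication by \<open>g\<close> permutes the nonzero elements and scales the sum by
  \<open>chi k g\<close>, which is not 1.\<close>

lemma sum_chi_eq_0:
  assumes "\<not> N dvd k"
  shows "(\<Sum>x\<in>-{0}. chi k x) = 0"
proof -
  have "(\<Sum>x\<in>-{0}. chi k x) = (\<Sum>x\<in>-{0}. chi k (g * x))"
    by (rule sum.reindex_bij_witness[of _ "\<lambda>x. g * x" "\<lambda>x. x / g"]) auto
  also have "\<dots> = chi k g * (\<Sum>x\<in>-{0}. chi k x)"
    by (simp add: sum_distrib_left chi_mult)
  finally have "(1 - chi k g) * (\<Sum>x\<in>-{0}. chi k x) = 0"
    by (simp add: algebra_simps)
  moreover have "chi k g \<noteq> 1"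
    using chi_power[of k 1] assms by (simp add: omega_power_eq_1_iff)
  ultimately show ?thesis by simp
qed

text \<open>A geometric sum in \<open>z = chi (N div p) x\<close>, where \<open>z ^ p = 1\<close>,
  and \<open>z = 1\<close> exactly when \<open>p\<close> divides \<open>dlog x\<close>.\<close>

lemma sum_chi_prime:
  assumes "p > 0" "p dvd N"
  shows "(\<Sum>a<p. chi (a * (N div p)) x) = (if p dvd dlog x then of_nat p else 0)"
proof -
  define z where "z = chi (N div p) x"
  have Np: "p * (N div p) = N" using assms(2) by simp
  have z1: "z = 1 \<longleftrightarrow> p dvd dlog x"
  proof -
    have "z = 1 \<longleftrightarrow> (N div p) * p dvd (N div p) * dlog x"
      using Np by (simp add: z_def chi_def omega_power_eq_1_iff mult.commute)
    also have "\<dots> \<longleftrightarrow> p dvd dlog x"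
      using Np N_pos by (metis dvd_times_left_cancel_iff mult_is_0 not_gr_zero)
    finally show ?thesis .
  qed
  have "z ^ p = chi N x" by (simp add: z_def chi_mult_left [symmetric] Np)
  also have "\<dots> = 1" by (simp add: chi_def omega_power_eq_1_iff)
  finally have zp: "z ^ p = 1" .
  have "(\<Sum>a<p. chi (a * (N div p)) x) = (\<Sum>a<p. z ^ a)"
    by (simp add: chi_mult_left z_def)
  also have "\<dots> = (if p dvd dlog x then of_nat p else 0)"
    using z1 zp geometric_sum[of z p] by auto
  finally show ?thesis .
qed

lemma dvd_dlog_power:
  assumes "p dvd N" "p dvd d" "x \<noteq> 0"
  shows "p dvd dlog (x ^ d)"
proof -
  have "g ^ dlog (x ^ d) = g ^ (dlog x * d)"
    using assms(3) by (simp add: power_dlog power_mult)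
  then have "dlog (x ^ d) mod N = dlog x * d mod N"
    by (simp add: power_eq_iff)
  then show ?thesis
    using assms(1,2) by (metis dvd_mod_iff dvd_mult)
qed

text \<open>A \<open>d\<close>-th power with \<open>d \<noteq> 1\<close> is a \<open>p\<close>-th
  power for any prime \<open>p\<close> dividing \<open>d\<close>, and for \<open>p\<close> dividing
  \<open>N\<close> the nonzero \<open>p\<close>-th powers are the elements whose logarithm is
  divisible by \<open>p\<close>.\<close>

lemma m_free_iff_dlog:
  assumes "m dvd N" "x \<noteq> 0"
  shows "m_free m x \<longleftrightarrow> (\<forall>p\<in>prime_factors m. \<not> p dvd dlog x)"
proof
  have m0: "m \<noteq> 0" using assms(1) N_pos by auto
  show "m_free m x \<Longrightarrow> \<forall>p\<in>prime_factors m. \<not> p dvd dlog x"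
  proof (intro ballI notI)
    fix p assume free: "m_free m x" and p: "p \<in> prime_factors m" "p dvd dlog x"
    have "x = (g ^ (dlog x div p)) ^ p"
      using p(2) assms(2) by (simp add: power_mult [symmetric] power_dlog)
    moreover have "p dvd m" "p \<noteq> 1" using p(1) by (auto simp: prime_factors_dvd in_prime_factors_iff)
    ultimately show False using free unfolding m_free_def by (metis g_nonzero power_not_zero)
  qed
  assume *: "\<forall>p\<in>prime_factors m. \<not> p dvd dlog x"
  show "m_free m x"
    unfolding m_free_def
  proof (intro allI impI, rule ccontr)
    fix d \<zeta> assume d: "d dvd m \<and> \<zeta> \<noteq> 0 \<and> x = \<zeta> ^ d" and "d \<noteq> 1"
    then obtain p where p: "prime p" "p dvd d" using prime_factor_nat by blast
    then have "p dvd dlog x"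
      using d dvd_dlog_power[of p d \<zeta>] assms(1) by (meson dvd_trans)
    moreover have "p \<in> prime_factors m"
      using p d m0 by (auto simp: in_prime_factors_iff)
    ultimately show False using * by blast
  qed
qed

end

section \<open>The trace\<close>

text \<open>Translation by 1 permutes the field; comparing the sums of all elements before and after
  shows that \<open>CARD('a)\<close> vanishes in the field.\<close>

lemma CHAR_dvd_CARD: "CHAR('a::finite_field) dvd CARD('a)"
proof -
  have "(\<Sum>x\<in>UNIV. x + 1 :: 'a) = (\<Sum>x\<in>UNIV. x)"
    by (rule sum.reindex_bij_witness[of _ "\<lambda>x. x - 1" "\<lambda>x. x + 1"]) auto
  then have "of_nat CARD('a) = (0::'a)"
    by (simp add: sum.distrib)
  then show ?thesis by (simp add: of_nat_eq_0_iff_char_dvd)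
qed

locale subfield_trace =
  fixes K :: "'a::finite_field set" and q n :: nat
  assumes q_primepow: "primepow q" and n_pos: "n > 0"
    and card_field: "CARD('a) = q ^ n"
    and subfield: "is_subfield K" and card_K: "card K = q"
begin

abbreviation Tr :: "'a \<Rightarrow> 'a" where "Tr \<equiv> field_trace q n"

lemma q_gt_1: "q > 1"
  using q_primepow by (rule primepow_gt_Suc_0[unfolded One_nat_def[symmetric]])

text \<open>Makes raising to the power \<open>q\<close> an iterate of Frobenius, hence additive. The
  characteristic is a prime dividing \<open>q ^ n\<close>, so it is the prime underlying
  \<open>q\<close>.\<close>

lemma q_power_CHAR: "\<exists>e. q = CHAR('a) ^ e"
proof -
  obtain r e where r: "prime r" "q = r ^ e"
    using q_primepow by (auto simp: primepow_def)
  have "prime CHAR('a)" by (rule prime_CHAR_semidom) simp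
  moreover have "CHAR('a) dvd (r ^ e) ^ n"
    using CHAR_dvd_CARD[where 'a='a] by (simp add: card_field r)
  ultimately have "CHAR('a) = r"
    using r(1) by (metis prime_dvd_power primes_dvd_imp_eq)
  with r show ?thesis by blast
qed

lemma frobenius_add: "(x + y :: 'a) ^ (q ^ i) = x ^ (q ^ i) + y ^ (q ^ i)"
proof -
  obtain e where "q = CHAR('a) ^ e" using q_power_CHAR by blast
  then have "q ^ i = CHAR('a) ^ (e * i)" by (simp add: power_mult)
  then show ?thesis
    by (intro freshmans_dream') (auto intro: prime_CHAR_semidom)
qed

lemma frobenius_sum: "(\<Sum>i\<in>I. f i :: 'a) ^ q = (\<Sum>i\<in>I. f i ^ q)"
proof -
  obtain e where "q = CHAR('a) ^ e" using q_power_CHAR by blast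
  then show ?thesis
    by (intro freshmans_dream_sum') (auto intro: prime_CHAR_semidom)
qed

lemma K_closed:
  shows zero_in_K: "0 \<in> K"
    and mult_in_K: "x \<in> K \<Longrightarrow> y \<in> K \<Longrightarrow> x * y \<in> K"
    and inverse_in_K: "x \<in> K \<Longrightarrow> inverse x \<in> K"
    and divide_in_K: "x \<in> K \<Longrightarrow> y \<in> K \<Longrightarrow> x / y \<in> K"
  using subfield by (auto simp: is_subfield_def divide_inverse)

lemma power_q_of_K:
  assumes "x \<in> K"
  shows "x ^ q = x"
proof (cases "x = 0")
  case False
  \<comment> \<open>Multiplication by \<open>x\<close> permutes \<open>K - {0}\<close>, so the
    factor \<open>x ^ (q - 1)\<close> can be cancelled to 1.\<close>
  have "(\<Prod>y\<in>K-{0}. x * y) = (\<Prod>y\<in>K-{0}. y)"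
    by (rule prod.reindex_bij_witness[of _ "\<lambda>y. y / x" "\<lambda>y. x * y"])
       (use False assms in \<open>auto intro: mult_in_K divide_in_K\<close>)
  then have "x ^ (q - 1) * (\<Prod>y\<in>K-{0}. y) = (\<Prod>y\<in>K-{0}. y)"
    by (simp add: prod.distrib card_K zero_in_K)
  then have "x ^ (q - 1) = 1" by simp
  then have "x * x ^ (q - 1) = x" by simp
  then show ?thesis using q_gt_1 by (simp flip: power_Suc)
qed (use q_gt_1 in auto)

text \<open>The polynomial \<open>X^q - X\<close> has at most \<open>q\<close> roots, and the
  \<open>q\<close> elements of \<open>K\<close> are among them.\<close>

lemma in_K_iff: "x \<in> K \<longleftrightarrow> x ^ q = x"
proof -
  define P where "P = Polynomial.monom (1::'a) q - Polynomial.monom 1 1"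
  have deg: "Polynomial.degree P = q"
    unfolding P_def using q_gt_1
    by (subst diff_conv_add_uminus, subst degree_add_eq_left) (simp_all add: degree_monom_eq)
  have "P \<noteq> 0" using deg q_gt_1 by auto
  then have "card {x. poly P x = 0} \<le> q"
    using card_poly_roots_bound[of P] deg by simp
  moreover have "{x. poly P x = 0} = {x. x ^ q = x}"
    by (simp add: P_def poly_monom)
  ultimately have "card {x::'a. x ^ q = x} \<le> card K" by (simp add: card_K)
  moreover have "K \<subseteq> {x. x ^ q = x}" using power_q_of_K by auto
  ultimately have "K = {x. x ^ q = x}" by (intro card_seteq) auto
  then show ?thesis by blast
qed

text \<open>Raising to the power \<open>q\<close> shifts the summands by one place; the term
  \<open>x ^ (q ^ n)\<close> gained at the end equals the term \<open>x\<close> lost at the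
  start.\<close>

lemma Tr_in_K: "Tr x \<in> K"
proof -
  have "Tr x ^ q = (\<Sum>i<n. x ^ (q ^ Suc i))"
    by (simp add: field_trace_def frobenius_sum mult.commute flip: power_mult)
  also have "\<dots> = (\<Sum>i<Suc n. x ^ (q ^ i)) - x"
    by (subst sum.lessThan_Suc_shift) simp
  also have "\<dots> = Tr x"
    using finite_field_power_card_eq_same[of x] by (simp add: field_trace_def card_field)
  finally show ?thesis by (simp add: in_K_iff)
qed

lemma Tr_add: "Tr (x + y) = Tr x + Tr y"
  by (simp add: field_trace_def frobenius_add sum.distrib)

lemma Tr_diff: "Tr (x - y) = Tr x - Tr y"
  using Tr_add[of "x - y" y] by simp

lemma Tr_scale:
  assumes "c \<in> K"
  shows "Tr (c * x) = c * Tr x"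
proof -
  have "c ^ (q ^ i) = c" for i
    by (induction i) (use assms in_K_iff in \<open>auto simp: power_mult\<close>)
  then show ?thesis
    by (simp add: field_trace_def power_mult_distrib sum_distrib_left)
qed

lemma Tr_0 [simp]: "Tr 0 = 0"
  using Tr_diff[of 0 0] by simp

lemma card_fibre_le: "card {x. Tr x = b} \<le> q ^ (n - 1)"
proof -
  define P where "P = (\<Sum>i<n. Polynomial.monom (1::'a) (q ^ i)) - [:b:]"
  have pos: "q ^ (n - 1) > 0" using q_gt_1 by simp
  have "Polynomial.degree P \<le> q ^ (n - 1)"
    unfolding P_def
  proof (intro degree_diff_le degree_sum_le)
    fix i assume "i \<in> {..<n}"
    then show "Polynomial.degree (Polynomial.monom (1::'a) (q ^ i)) \<le> q ^ (n - 1)"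
      using q_gt_1 by (simp add: degree_monom_eq power_increasing)
  qed auto
  moreover have "P \<noteq> 0"
  proof -
    \<comment> \<open>The exponents \<open>q ^ i\<close> are distinct, and \<open>[:b:]\<close> only
      affects degree 0, which differs from \<open>q ^ (n - 1)\<close>.\<close>
    have "Polynomial.coeff P (q ^ (n - 1)) = (\<Sum>i<n. if i = n - 1 then 1 else 0)"
      using pos q_gt_1 by (auto simp: P_def coeff_sum coeff_pCons' power_inject_exp intro!: sum.cong)
    also have "\<dots> = 1" using n_pos by simp
    finally show ?thesis by auto
  qed
  moreover have "{x. poly P x = 0} = {x. Tr x = b}"
    by (simp add: P_def poly_sum poly_monom field_trace_def)
  ultimately show ?thesis
    using card_poly_roots_bound[of P] by simp
qed

text \<open>The \<open>q\<close> fibres over \<open>K\<close> share \<open>q ^ n\<close> elements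
  and none exceeds \<open>q ^ (n - 1)\<close>, so none can fall short of it.\<close>

lemma card_fibre:
  assumes "b \<in> K"
  shows "card {x. Tr x = b} = q ^ (n - 1)"
proof (rule ccontr)
  assume "card {x. Tr x = b} \<noteq> q ^ (n - 1)"
  with card_fibre_le[of b] have "card {x. Tr x = b} < q ^ (n - 1)" by simp
  then have "(\<Sum>b\<in>K. card {x. Tr x = b}) < (\<Sum>b\<in>K. q ^ (n - 1))"
    using assms card_fibre_le by (intro sum_strict_mono_ex1) auto
  also have "\<dots> = q ^ n"
    using n_pos by (simp add: card_K flip: power_Suc)
  finally have "(\<Sum>b\<in>K. card {x. Tr x = b}) < q ^ n" .
  moreover have "(\<Sum>b\<in>K. card {x. Tr x = b}) = CARD('a)"
    using sum.group[of UNIV K Tr "\<lambda>_. 1::nat"] Tr_in_K by auto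
  ultimately show False by (simp add: card_field)
qed

end

section \<open>Sieving by primes\<close>

lemma norm_average_le:
  assumes "p > 1" and "\<And>a. a \<in> {1..<p} \<Longrightarrow> norm (f a) \<le> M"
  shows "norm (1 / (of_nat p - 1) * (\<Sum>a=1..<p. f a :: complex)) \<le> M"
proof -
  have p: "norm (of_nat p - 1 :: complex) = real p - 1"
    using assms(1) by (metis Num.of_nat_simps(2) less_imp_le_nat norm_of_nat of_nat_diff)
  have "norm (\<Sum>a=1..<p. f a) \<le> (\<Sum>a=1..<p. M)"
    using assms(2) by (rule sum_norm_le)
  also have "\<dots> = (real p - 1) * M" using assms(1) by (simp add: of_nat_diff)
  finally show ?thesis
    using assms(1) by (simp add: norm_divide p field_simps)
qed

context field_generator
begin

text \<open>Without its term \<open>a = 0\<close> the sum of \<open>sum_chi_prime\<close> is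
  \<open>p - 1\<close> or \<open>-1\<close>. The second factor is therefore 0 or
  \<open>p / (p - 1)\<close>, and the first factor normalizes the latter to 1.\<close>

lemma sieve_indicator:
  assumes p: "prime p" "p dvd N"
  shows "(1 - 1 / of_nat p) * (1 - 1 / (of_nat p - 1) * (\<Sum>a=1..<p. chi (a * (N div p)) x))
    = (if p dvd dlog x then 0 else 1)"
proof -
  have p1: "p > 1" using p(1) by (rule prime_gt_1_nat)
  have "{..<p} = insert 0 {1..<p}" using p1 by auto
  then have "(\<Sum>a<p. chi (a * (N div p)) x) = 1 + (\<Sum>a=1..<p. chi (a * (N div p)) x)"
    by simp
  then have s: "(\<Sum>a=1..<p. chi (a * (N div p)) x) = (if p dvd dlog x then of_nat p else 0) - 1"
    using sum_chi_prime[OF _ p(2), of x] p1 by (simp add: algebra_simps)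
  have "of_nat p \<noteq> (0::complex)" "of_nat p - 1 \<noteq> (0::complex)"
    using p1 by simp_all
  then show ?thesis unfolding s by (simp add: field_simps)
qed

definition sieved :: "'a set \<Rightarrow> nat set \<Rightarrow> 'a set" where
  "sieved X S = {x\<in>X. \<forall>p\<in>S. \<not> p dvd dlog x}"

lemma sieve_step:
  assumes p: "prime p" "p dvd N"
  shows "(\<Sum>x\<in>sieved X (insert p S). chi k x) =
    (1 - 1 / of_nat p) * ((\<Sum>x\<in>sieved X S. chi k x) -
      1 / (of_nat p - 1) * (\<Sum>a=1..<p. \<Sum>x\<in>sieved X S. chi (k + a * (N div p)) x))"
proof -
  have "(\<Sum>x\<in>sieved X (insert p S). chi k x) =
    (\<Sum>x\<in>sieved X S. (if p dvd dlog x then 0 else 1) * chi k x)"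
    by (rule sum.mono_neutral_cong_left) (auto simp: sieved_def)
  also have "\<dots> = (\<Sum>x\<in>sieved X S. (1 - 1 / of_nat p) *
      (chi k x - 1 / (of_nat p - 1) * (\<Sum>a=1..<p. chi (k + a * (N div p)) x)))"
    unfolding sieve_indicator[OF p, symmetric]
    by (intro sum.cong refl) (simp add: chi_add sum_distrib_left algebra_simps)
  also have "\<dots> = (1 - 1 / of_nat p) * ((\<Sum>x\<in>sieved X S. chi k x) -
      1 / (of_nat p - 1) * (\<Sum>x\<in>sieved X S. \<Sum>a=1..<p. chi (k + a * (N div p)) x))"
    by (simp only: sum_subtractf sum_distrib_left [symmetric])
  also have "(\<Sum>x\<in>sieved X S. \<Sum>a=1..<p. chi (k + a * (N div p)) x) =
      (\<Sum>a=1..<p. \<Sum>x\<in>sieved X S. chi (k + a * (N div p)) x)"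
    by (rule sum.swap)
  finally show ?thesis .
qed

text \<open>Each sieving step replaces a sum by the difference of itself and an average of twists,
  which at most doubles the bound. The condition \<open>\<not> N dvd k * \<Prod>S\<close> ensures
  that no twist by characters of orders in \<open>S\<close> makes \<open>chi k\<close>
  trivial.\<close>

lemma norm_sum_sieved_le:
  assumes bound: "\<And>k. \<not> N dvd k \<Longrightarrow> norm (\<Sum>x\<in>X. chi k x) \<le> B"
    and "finite S" "\<And>p. p \<in> S \<Longrightarrow> prime p \<and> p dvd N" "\<not> N dvd k * \<Prod>S"
  shows "norm (\<Sum>x\<in>sieved X S. chi k x) \<le> (\<Prod>p\<in>S. 1 - 1 / real p) * 2 ^ card S * B"
  using assms(2-)
proof (induction S arbitrary: k rule: finite_induct)
  case empty
  then show ?case using bound[of k] by (simp add: sieved_def)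
next
  case (insert p S)
  have p: "prime p" "p dvd N" using insert.prems(1) by auto
  have p1: "p > 1" using p(1) by (rule prime_gt_1_nat)
  define M where "M = (\<Prod>p\<in>S. 1 - 1 / real p) * 2 ^ card S * B"
  have nd: "\<not> N dvd (k + a * (N div p)) * \<Prod>S" for a
  proof
    assume "N dvd (k + a * (N div p)) * \<Prod>S"
    then have "N dvd (k + a * (N div p)) * \<Prod>S * p" by simp
    \<comment> \<open>Multiplying by \<open>p\<close> turns the twist into a multiple of
      \<open>N\<close>, which leaves \<open>k * \<Prod>(insert p S)\<close> to contradict the
      assumption.\<close>
    also have "(k + a * (N div p)) * \<Prod>S * p = k * \<Prod>(insert p S) + a * \<Prod>S * ((N div p) * p)"
      using insert.hyps by (simp add: algebra_simps)
    also have "\<dots> = k * \<Prod>(insert p S) + a * \<Prod>S * N"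
      using p(2) by simp
    finally show False using insert.prems(2) by (simp add: dvd_add_left_iff)
  qed
  have IH: "norm (\<Sum>x\<in>sieved X S. chi (k + a * (N div p)) x) \<le> M" for a
    unfolding M_def using insert.prems(1) nd by (intro insert.IH) auto
  have "norm (1 / (of_nat p - 1) * (\<Sum>a=1..<p. \<Sum>x\<in>sieved X S. chi (k + a * (N div p)) x)) \<le> M"
    using p1 IH by (intro norm_average_le)
  moreover have "norm (\<Sum>x\<in>sieved X S. chi k x) \<le> M" using IH[of 0] by simp
  ultimately have "norm ((\<Sum>x\<in>sieved X S. chi k x) -
      1 / (of_nat p - 1) * (\<Sum>a=1..<p. \<Sum>x\<in>sieved X S. chi (k + a * (N div p)) x)) \<le> M + M"
    by (intro order_trans[OF norm_triangle_ineq4] add_mono)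
  moreover have "norm (1 - 1 / of_nat p :: complex) = 1 - 1 / real p"
  proof -
    have "(1 - 1 / of_nat p :: complex) = of_real (1 - 1 / real p)" by simp
    then show ?thesis using p1 by (simp only: norm_of_real) simp
  qed
  ultimately have "norm (\<Sum>x\<in>sieved X (insert p S). chi k x) \<le> (1 - 1 / real p) * (M + M)"
    unfolding sieve_step[OF p] norm_mult using p1 by (intro mult_mono) auto
  also have "\<dots> = (\<Prod>p\<in>insert p S. 1 - 1 / real p) * 2 ^ card (insert p S) * B"
    using insert.hyps by (simp add: M_def)
  finally show ?case .
qed

text \<open>Adding \<open>p\<close> subtracts an average of sums over nontrivial characters of order
  \<open>p\<close>, each bounded with the factor \<open>2 ^ card S\<close>. The errors add up as
  \<open>(2 ^ card S - 1) + 2 ^ card S = 2 ^ (card S + 1) - 1\<close>.\<close>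

theorem card_sieved_ge:
  assumes bound: "\<And>k. \<not> N dvd k \<Longrightarrow> norm (\<Sum>x\<in>X. chi k x) \<le> B"
    and "finite S" "\<And>p. p \<in> S \<Longrightarrow> prime p \<and> p dvd N"
  shows "real (card (sieved X S)) \<ge>
    (\<Prod>p\<in>S. 1 - 1 / real p) * (real (card X) - (2 ^ card S - 1) * B)"
  using assms(2-)
proof (induction S rule: finite_induct)
  case empty
  then show ?case by (simp add: sieved_def)
next
  case (insert p S)
  have p: "prime p" "p dvd N" using insert.prems(1) by auto
  have p1: "p > 1" using p(1) by (rule prime_gt_1_nat)
  define D where "D = (\<Prod>p\<in>S. 1 - 1 / real p)"
  define E where "E = 1 / (of_nat p - 1) * (\<Sum>a=1..<p. \<Sum>x\<in>sieved X S. chi (0 + a * (N div p)) x)"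
  have "norm E \<le> D * 2 ^ card S * B"
    unfolding E_def
  proof (rule norm_average_le[OF p1])
    fix a assume a: "a \<in> {1..<p}"
    \<comment> \<open>The prime \<open>p\<close> divides neither \<open>a\<close>, as
      \<open>0 < a < p\<close>, nor any of the other primes in \<open>S\<close>.\<close>
    have "\<not> N dvd (0 + a * (N div p)) * \<Prod>S"
    proof
      assume "N dvd (0 + a * (N div p)) * \<Prod>S"
      then have "(N div p) * p dvd (N div p) * (a * \<Prod>S)" using p(2) by (simp add: mult_ac)
      then have "p dvd a * \<Prod>S"
        using p(2) N_pos by (metis dvd_div_eq_0_iff dvd_times_left_cancel_iff not_gr_zero)
      moreover have "\<not> p dvd a" using a by (auto dest: dvd_imp_le)
      ultimately have "p dvd \<Prod>S" using p(1) prime_dvd_mult_iff by blast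
      then obtain r where "r \<in> S" "p dvd r"
        using p(1) insert.hyps(1) by (auto simp: prime_dvd_prod_iff)
      then show False
        using insert.hyps insert.prems p(1) primes_dvd_imp_eq by (metis insertI2)
    qed
    then show "norm (\<Sum>x\<in>sieved X S. chi (0 + a * (N div p)) x) \<le> D * 2 ^ card S * B"
      unfolding D_def using insert.prems insert.hyps(1) bound by (intro norm_sum_sieved_le) auto
  qed
  then have E: "Re E \<le> D * 2 ^ card S * B"
    using complex_Re_le_cmod[of E] by linarith
  have "of_nat (card (sieved X (insert p S))) = (1 - 1 / of_nat p) * (of_nat (card (sieved X S)) - E)"
    using sieve_step[OF p, where X = X and S = S and k = 0] unfolding E_def by simp
  also have "\<dots> = of_real (1 - 1 / real p) * (of_nat (card (sieved X S)) - E)" by simp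
  finally have "Re (of_nat (card (sieved X (insert p S)))) =
      Re (of_real (1 - 1 / real p) * (of_nat (card (sieved X S)) - E))" by simp
  then have "real (card (sieved X (insert p S))) = (1 - 1 / real p) * (real (card (sieved X S)) - Re E)"
    by (simp only: Re_complex_of_real complex_Re_of_nat times_complex.sel minus_complex.sel Im_complex_of_real)
  also have "\<dots> \<ge> (1 - 1 / real p) * (D * (real (card X) - (2 ^ card S - 1) * B) - D * 2 ^ card S * B)"
    using insert.IH insert.prems E p1 unfolding D_def by (intro mult_left_mono diff_mono) auto
  also have "(1 - 1 / real p) * (D * (real (card X) - (2 ^ card S - 1) * B) - D * 2 ^ card S * B) =
      (\<Prod>p\<in>insert p S. 1 - 1 / real p) * (real (card X) - (2 ^ card (insert p S) - 1) * B)"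
    using insert.hyps by (simp add: D_def algebra_simps add_divide_distrib)
  finally show ?case .
qed

end

section \<open>Character sums over trace conditions\<close>

locale trace_generator = field_generator g N + subfield_trace K q n
  for g :: "'a::finite_field" and N and K :: "'a set" and q n
begin

definition trace_sum :: "nat \<Rightarrow> 'a \<Rightarrow> complex" where
  "trace_sum k b = (\<Sum>y | y \<noteq> 0 \<and> Tr y = b. chi k y)"

section \<open>Second moment of the trace sums\<close>

lemma card_scaled_kernel:
  assumes "t \<noteq> 1"
  shows "card {z. z \<noteq> 0 \<and> Tr (z * t) = Tr z} = q ^ (n - 1) - 1"
proof -
  have "Tr (z * t) = Tr z \<longleftrightarrow> Tr (z * (t - 1)) = 0" for z
    by (simp add: right_diff_distrib Tr_diff)
  then have "card {z. z \<noteq> 0 \<and> Tr (z * t) = Tr z} = card {z. z \<noteq> 0 \<and> Tr (z * (t - 1)) = 0}"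
    by simp
  also have "\<dots> = card ({w. Tr w = 0} - {0})"
    by (rule bij_betw_same_card[of "\<lambda>z. z * (t - 1)"],
        rule bij_betw_byWitness[of _ "\<lambda>w. w / (t - 1)"])
       (use assms in auto)
  also have "\<dots> = q ^ (n - 1) - 1"
    using card_fibre[OF zero_in_K] by (simp add: card_Diff_subset)
  finally show ?thesis .
qed

lemma sum_norm_trace_sum_squared:
  assumes "\<not> N dvd k"
  shows "(\<Sum>b\<in>K. (norm (trace_sum k b))\<^sup>2) = real q ^ n - real q ^ (n - 1)"
proof -
  let ?F = "- {0::'a}"
  have shift: "cnj (chi k z) * trace_sum k (Tr z) = (\<Sum>t\<in>?F. if Tr (z * t) = Tr z then chi k t else 0)"
    if z: "z \<in> ?F" for z
  proof -
    have "cnj (chi k z) * trace_sum k (Tr z) = (\<Sum>y | y \<noteq> 0 \<and> Tr y = Tr z. cnj (chi k z) * chi k y)"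
      by (simp add: trace_sum_def sum_distrib_left)
    also have "\<dots> = (\<Sum>t | t \<noteq> 0 \<and> Tr (z * t) = Tr z. chi k t)"
    proof (rule sum.reindex_bij_witness[of _ "\<lambda>t. z * t" "\<lambda>y. y / z"])
      fix y assume y: "y \<in> {y. y \<noteq> 0 \<and> Tr y = Tr z}"
      have "chi k y = chi k z * chi k (y / z)"
        using y z chi_mult[of z "y / z" k] by simp
      then have "cnj (chi k z) * chi k y = (chi k z * cnj (chi k z)) * chi k (y / z)"
        by (simp add: mult_ac)
      then show "chi k (y / z) = cnj (chi k z) * chi k y"
        by (simp flip: complex_norm_square)
    qed (use z in auto)
    also have "\<dots> = (\<Sum>t\<in>?F. if Tr (z * t) = Tr z then chi k t else 0)"
      by (rule sum.mono_neutral_cong_left) auto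
    finally show ?thesis .
  qed
  \<comment> \<open>The count is split into a part independent of \<open>t\<close>, which
    \<open>sum_chi_eq_0\<close> removes after weighting by \<open>chi k t\<close>, and an excess at
    \<open>t = 1\<close>, which alone survives.\<close>
  have cnt: "of_nat (card {z. z \<noteq> 0 \<and> Tr (z * t) = Tr z}) =
      (of_nat (q ^ (n - 1)) - 1 + (if t = 1 then of_nat (q ^ n) - of_nat (q ^ (n - 1)) else 0) :: complex)" for t
  proof (cases "t = 1")
    case True
    have "{z. z \<noteq> (0::'a)} = - {0}" by auto
    then have "card {z. z \<noteq> (0::'a)} = q ^ n - 1" by (simp add: Compl_eq_Diff_UNIV card_Diff_subset card_field)
    then show ?thesis using True q_gt_1 by (simp add: of_nat_diff)
  next
    case False
    then show ?thesis using q_gt_1 by (simp add: card_scaled_kernel of_nat_diff)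
  qed
  have "complex_of_real (\<Sum>b\<in>K. (norm (trace_sum k b))\<^sup>2) = (\<Sum>b\<in>K. cnj (trace_sum k b) * trace_sum k b)"
    by (simp only: of_real_sum complex_norm_square mult.commute)
  also have "\<dots> = (\<Sum>b\<in>K. \<Sum>z\<in>{z\<in>?F. Tr z = b}. cnj (chi k z) * trace_sum k (Tr z))"
  proof (intro sum.cong refl)
    fix b
    have "{z\<in>?F. Tr z = b} = {z. z \<noteq> 0 \<and> Tr z = b}" by auto
    then have "cnj (trace_sum k b) * trace_sum k b = (\<Sum>z\<in>{z\<in>?F. Tr z = b}. cnj (chi k z) * trace_sum k b)"
      unfolding trace_sum_def by (simp add: sum_distrib_right)
    then show "cnj (trace_sum k b) * trace_sum k b = (\<Sum>z\<in>{z\<in>?F. Tr z = b}. cnj (chi k z) * trace_sum k (Tr z))"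
      by (auto intro!: sum.cong)
  qed
  also have "\<dots> = (\<Sum>z\<in>?F. cnj (chi k z) * trace_sum k (Tr z))"
    using Tr_in_K by (intro sum.group) auto
  also have "\<dots> = (\<Sum>z\<in>?F. \<Sum>t\<in>?F. if Tr (z * t) = Tr z then chi k t else 0)"
    by (intro sum.cong refl shift)
  also have "\<dots> = (\<Sum>t\<in>?F. \<Sum>z\<in>?F. if Tr (z * t) = Tr z then chi k t else 0)"
    by (rule sum.swap)
  also have "\<dots> = (\<Sum>t\<in>?F. \<Sum>z | z \<noteq> 0 \<and> Tr (z * t) = Tr z. chi k t)"
    by (intro sum.cong refl sum.mono_neutral_cong_right) auto
  also have "\<dots> = (\<Sum>t\<in>?F. (of_nat (q ^ (n - 1)) - 1) * chi k t +
      (if t = 1 then of_nat (q ^ n) - of_nat (q ^ (n - 1)) else 0) * chi k t)"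
    by (simp only: sum_constant cnt distrib_right)
  also have "\<dots> = (\<Sum>t\<in>?F. if t = 1 then (of_nat (q ^ n) - of_nat (q ^ (n - 1))) * chi k 1 else 0)"
    by (simp only: sum.distrib sum_distrib_left [symmetric] sum_chi_eq_0[OF assms]
          mult_zero_right add_0_left) (rule sum.cong, auto)
  also have "\<dots> = of_nat (q ^ n) - of_nat (q ^ (n - 1))"
    using chi_power[of k 0] by simp
  also have "\<dots> = complex_of_real (real q ^ n - real q ^ (n - 1))" by simp
  finally show ?thesis by (simp only: of_real_eq_iff)
qed

text \<open>The trace is \<open>K\<close>-linear, so \<open>y \<mapsto> c * y\<close> carries one
  fibre to the other and contributes only the unimodular factor \<open>chi k c\<close>.\<close>

lemma norm_trace_sum_scale:
  assumes "c \<in> K" "c \<noteq> 0"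
  shows "norm (trace_sum k (c * b)) = norm (trace_sum k b)"
proof -
  have "trace_sum k (c * b) = (\<Sum>y | y \<noteq> 0 \<and> Tr y = b. chi k (c * y))"
    unfolding trace_sum_def
    by (rule sum.reindex_bij_witness[of _ "\<lambda>y. c * y" "\<lambda>y. inverse c * y"])
       (use assms in \<open>auto simp: Tr_scale inverse_in_K simp flip: mult.assoc\<close>)
  also have "\<dots> = chi k c * trace_sum k b"
    using assms by (auto simp: trace_sum_def sum_distrib_left chi_mult intro!: sum.cong)
  finally show ?thesis by (simp add: norm_mult)
qed

text \<open>The second moment is \<open>(q - 1) * q ^ (n - 1)\<close>, and the \<open>q - 1\<close>
  nonzero elements of \<open>K\<close> contribute equal terms to it; the term at 0 is nonnegative
  and is dropped.\<close>

lemma norm_trace_sum_le: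
  assumes "\<not> N dvd k" "\<beta> \<in> K" "\<beta> \<noteq> 0"
  shows "(norm (trace_sum k \<beta>))\<^sup>2 \<le> real q ^ (n - 1)"
proof -
  have const: "norm (trace_sum k b) = norm (trace_sum k \<beta>)" if "b \<in> K - {0}" for b
    using norm_trace_sum_scale[of "b / \<beta>" k \<beta>] that assms divide_in_K by auto
  have "(\<Sum>b\<in>K - {0}. (norm (trace_sum k b))\<^sup>2) = (\<Sum>b\<in>K - {0}. (norm (trace_sum k \<beta>))\<^sup>2)"
    by (intro sum.cong refl) (simp add: const)
  then have "(real q - 1) * (norm (trace_sum k \<beta>))\<^sup>2 = (\<Sum>b\<in>K - {0}. (norm (trace_sum k b))\<^sup>2)"
    using q_gt_1 by (simp add: card_K zero_in_K of_nat_diff)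
  also have "\<dots> \<le> (\<Sum>b\<in>K. (norm (trace_sum k b))\<^sup>2)"
    by (rule sum_mono2) auto
  also have "\<dots> = (real q - 1) * real q ^ (n - 1)"
    using sum_norm_trace_sum_squared[OF assms(1)] n_pos
    by (simp add: algebra_simps flip: power_Suc)
  finally show ?thesis using q_gt_1 by simp
qed

section \<open>Sums over elements whose square has prescribed trace\<close>

lemma one_neq_minus_one:
  assumes "odd q"
  shows "(1::'a) \<noteq> - 1"
proof
  assume "(1::'a) = - 1"
  then have "of_nat 2 = (0::'a)" by (simp add: eq_neg_iff_add_eq_0)
  then have "CHAR('a) dvd 2" by (simp only: of_nat_eq_0_iff_char_dvd)
  then have "CHAR('a) = 2"
    by (metis prime_CHAR_semidom CHAR_pos primes_dvd_imp_eq two_is_prime_nat)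
  then show False
    using q_power_CHAR assms q_gt_1 by (metis even_power dvd_refl less_numeral_extra(4) neq0_conv power_0)
qed

lemma even_N: "odd q \<Longrightarrow> even N"
  by (simp add: N_def card_field)

text \<open>The right side is 1 plus the quadratic character. A square \<open>r^2\<close> with
  \<open>r \<noteq> 0\<close> has the roots \<open>r\<close> and \<open>- r\<close>, distinct in odd
  characteristic.\<close>

lemma card_square_roots:
  assumes "odd q" "y \<noteq> 0"
  shows "of_nat (card {x. x\<^sup>2 = y}) = chi 0 y + chi (N div 2) y"
proof -
  have "card {x. x\<^sup>2 = y} = (if 2 dvd dlog y then 2 else 0)"
  proof (cases "2 dvd dlog y")
    case True
    define r where "r = g ^ (dlog y div 2)"
    have r: "r\<^sup>2 = y" "r \<noteq> 0"
      using True power_dlog[OF assms(2)] by (simp_all add: r_def flip: power_mult)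
    then have "{x. x\<^sup>2 = y} = {r, - r}" by (auto simp: power2_eq_iff)
    moreover have "r \<noteq> - r"
    proof
      assume "r = - r"
      then have "r * 1 = r * - 1" by simp
      then show False using r(2) one_neq_minus_one[OF assms(1)] mult_left_cancel by blast
    qed
    ultimately show ?thesis using True by simp
  next
    case False
    have "x\<^sup>2 \<noteq> y" for x
      using False dvd_dlog_power[of 2 2 x] even_N[OF assms(1)] assms(2) by auto
    then show ?thesis using False by simp
  qed
  then show ?thesis
    using sum_chi_prime[of 2 y] even_N[OF assms(1)]
    by (simp add: numeral_2_eq_2)
qed

definition square_trace_sum :: "nat \<Rightarrow> 'a \<Rightarrow> complex" where
  "square_trace_sum k b = (\<Sum>x | x \<noteq> 0 \<and> Tr (x\<^sup>2) = b. chi k x)"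

text \<open>As \<open>chi (2 * l) x = chi l (x^2)\<close>, grouping by \<open>y = x^2\<close>
  weights \<open>chi l y\<close> with the number of square roots of \<open>y\<close>.\<close>

lemma square_trace_sum_even:
  assumes "odd q"
  shows "square_trace_sum (2 * l) b = trace_sum l b + trace_sum (l + N div 2) b"
proof -
  define X where "X = {x. x \<noteq> 0 \<and> Tr (x\<^sup>2) = b}"
  define Y where "Y = {y. y \<noteq> 0 \<and> Tr y = b}"
  have "square_trace_sum (2 * l) b = (\<Sum>x\<in>X. chi l (x\<^sup>2))"
    by (auto simp: square_trace_sum_def X_def chi_square intro!: sum.cong)
  also have "\<dots> = (\<Sum>y\<in>Y. \<Sum>x\<in>{x\<in>X. x\<^sup>2 = y}. chi l (x\<^sup>2))"
    by (rule sum.group [symmetric]) (auto simp: X_def Y_def)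
  also have "\<dots> = (\<Sum>y\<in>Y. chi l y + chi (l + N div 2) y)"
  proof (rule sum.cong)
    fix y assume y: "y \<in> Y"
    then have "{x\<in>X. x\<^sup>2 = y} = {x. x\<^sup>2 = y}" by (auto simp: X_def Y_def)
    then have "(\<Sum>x\<in>{x\<in>X. x\<^sup>2 = y}. chi l (x\<^sup>2)) = of_nat (card {x. x\<^sup>2 = y}) * chi l y"
      by simp
    also have "\<dots> = chi l y + chi (l + N div 2) y"
      using card_square_roots[OF assms, of y] y by (simp add: Y_def chi_add algebra_simps)
    finally show "(\<Sum>x\<in>{x\<in>X. x\<^sup>2 = y}. chi l (x\<^sup>2)) = chi l y + chi (l + N div 2) y" .
  qed simp
  finally show ?thesis by (simp add: trace_sum_def Y_def sum.distrib)
qed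

text \<open>Both \<open>g ^ (N div 2)\<close> and \<open>\<omega> ^ (N div 2)\<close> are square
  roots of 1 other than 1, hence \<open>- 1\<close>. So \<open>chi k (- 1) = - 1\<close> for odd
  \<open>k\<close>, while \<open>x \<mapsto> - x\<close> preserves the range of summation.\<close>

lemma square_trace_sum_odd:
  assumes "odd q" "odd k"
  shows "square_trace_sum k b = 0"
proof -
  let ?h = "N div 2"
  have h: "2 * ?h = N" using even_N[OF assms(1)] by simp
  have nd: "\<not> N dvd ?h" using h N_pos by (auto dest!: dvd_imp_le)
  have "(g ^ ?h)\<^sup>2 = 1" using h power_N[of g] by (simp add: mult.commute flip: power_mult)
  moreover have "g ^ ?h \<noteq> 1"
    using nd power_eq_iff[of ?h 0] by (simp add: dvd_eq_mod_eq_0)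
  ultimately have "g ^ ?h = - 1" by (simp add: power2_eq_1_iff)
  then have chi1: "chi k (- 1) = (\<omega> ^ ?h) ^ k"
    using chi_power[of k ?h] by (simp add: mult.commute flip: power_mult)
  have "(\<omega> ^ ?h)\<^sup>2 = 1" using h by (simp add: mult.commute omega_power_eq_1_iff flip: power_mult)
  moreover have "\<omega> ^ ?h \<noteq> 1" using nd by (simp add: omega_power_eq_1_iff)
  ultimately have "\<omega> ^ ?h = - 1" by (simp add: power2_eq_1_iff)
  with chi1 assms(2) have "chi k (- 1) = - 1" by simp
  then have neg: "chi k (- x) = - chi k x" if "x \<noteq> 0" for x
    using chi_mult[of "- 1" x k] that by simp
  have "square_trace_sum k b = (\<Sum>x | x \<noteq> 0 \<and> Tr (x\<^sup>2) = b. chi k (- x))"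
    unfolding square_trace_sum_def by (rule sum.reindex_bij_witness[of _ uminus uminus]) auto
  also have "\<dots> = - square_trace_sum k b" by (simp add: square_trace_sum_def neg sum_negf)
  finally show ?thesis by simp
qed

text \<open>The real number \<open>s\<close> is \<open>q^((n-1)/2)\<close>, fixed by its sign and
  its square because it need not be an integer.\<close>

context
  fixes \<beta> :: 'a and s :: real
  assumes odd_q: "odd q" and \<beta>: "\<beta> \<in> K" "\<beta> \<noteq> 0"
    and s: "s \<ge> 0" "s\<^sup>2 = real q ^ (n - 1)"
begin

lemma norm_trace_sum_le_sqrt: "\<not> N dvd k \<Longrightarrow> norm (trace_sum k \<beta>) \<le> s"
  using norm_trace_sum_le[OF _ \<beta>] s by (metis power2_le_imp_le)

lemma norm_square_trace_sum_le:
  assumes "\<not> N dvd k"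
  shows "norm (square_trace_sum k \<beta>) \<le> 2 * s"
proof (cases "even k")
  case True
  then obtain l where k: "k = 2 * l" by auto
  \<comment> \<open>Both halves of \<open>k\<close> modulo \<open>N\<close>, \<open>l\<close> and
    \<open>l + N div 2\<close>, give nontrivial characters, since doubling a multiple of
    \<open>N\<close> would make \<open>N\<close> divide \<open>k\<close>.\<close>
  have "2 * (l + N div 2) = k + N" using even_N[OF odd_q] k by simp
  then have "\<not> N dvd l + N div 2"
    using assms by (metis dvd_add_left_iff dvd_mult dvd_refl)
  moreover have "\<not> N dvd l" using assms k by auto
  ultimately have "norm (trace_sum l \<beta>) \<le> s" "norm (trace_sum (l + N div 2) \<beta>) \<le> s"
    by (auto intro: norm_trace_sum_le_sqrt)
  then show ?thesis
    unfolding k square_trace_sum_even[OF odd_q]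
    using norm_triangle_ineq[of "trace_sum l \<beta>" "trace_sum (l + N div 2) \<beta>"] by linarith
qed (simp add: square_trace_sum_odd odd_q s)

text \<open>The case \<open>k = 0\<close>: the trivial character contributes the full fibre, of size
  \<open>s^2\<close>, and the quadratic character at most \<open>s\<close> in absolute
  value.\<close>

lemma card_square_trace_ge:
  "real (card {x. x \<noteq> 0 \<and> Tr (x\<^sup>2) = \<beta>}) \<ge> s\<^sup>2 - s"
proof -
  have "{y. y \<noteq> 0 \<and> Tr y = \<beta>} = {y. Tr y = \<beta>}" using \<beta>(2) by auto
  then have U0: "trace_sum 0 \<beta> = of_real (s\<^sup>2)"
    by (simp add: trace_sum_def card_fibre[OF \<beta>(1)] s(2))
  have "\<not> N dvd N div 2"
    using even_N[OF odd_q] N_pos by (auto dest!: dvd_imp_le)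
  then have "- s \<le> Re (trace_sum (N div 2) \<beta>)"
    using norm_trace_sum_le_sqrt[of "N div 2"] abs_Re_le_cmod[of "trace_sum (N div 2) \<beta>"] by linarith
  moreover have "square_trace_sum 0 \<beta> = of_real (s\<^sup>2) + trace_sum (N div 2) \<beta>"
    using square_trace_sum_even[OF odd_q, of 0 \<beta>] U0 by simp
  then have "Re (square_trace_sum 0 \<beta>) = s\<^sup>2 + Re (trace_sum (N div 2) \<beta>)"
    by (simp only: plus_complex.sel Re_complex_of_real)
  moreover have "Re (square_trace_sum 0 \<beta>) = real (card {x. x \<noteq> 0 \<and> Tr (x\<^sup>2) = \<beta>})"
    by (simp add: square_trace_sum_def)
  ultimately show ?thesis by linarith
qed

theorem N_count_ge:
  assumes "m dvd N"
  shows "real (N_count q n \<beta> m) \<ge> \<theta> m * s * (s - 2 * 2 ^ card (prime_factors m) + 1)"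
proof -
  define P where "P = prime_factors m"
  define D where "D = (\<Prod>p\<in>P. 1 - 1 / real p)"
  define X where "X = {x. x \<noteq> 0 \<and> Tr (x\<^sup>2) = \<beta>}"
  have m0: "m > 0" using assms N_pos by (auto intro: Nat.gr0I)
  have D: "\<theta> m = D"
    using m0 by (simp add: \<theta>_def totient_formula2 D_def P_def)
  have D0: "D \<ge> 0"
    unfolding D_def P_def
    by (intro prod_nonneg) (auto simp: in_prime_factors_iff divide_le_eq dest: prime_gt_1_nat)
  have "N_count q n \<beta> m = card (sieved X P)"
    unfolding N_count_def sieved_def X_def P_def
    by (rule arg_cong[where f = card]) (auto simp: m_free_iff_dlog[OF assms])
  moreover have "real (card (sieved X P)) \<ge> D * (real (card X) - (2 ^ card P - 1) * (2 * s))"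
    unfolding D_def
  proof (rule card_sieved_ge)
    show "norm (\<Sum>x\<in>X. chi k x) \<le> 2 * s" if "\<not> N dvd k" for k
      using norm_square_trace_sum_le[OF that] by (simp add: square_trace_sum_def X_def)
    show "prime p \<and> p dvd N" if "p \<in> P" for p
      using that assms by (auto simp: P_def in_prime_factors_iff intro: dvd_trans)
  qed (simp add: P_def)
  moreover have "D * (real (card X) - (2 ^ card P - 1) * (2 * s)) \<ge>
      D * (s\<^sup>2 - s - (2 ^ card P - 1) * (2 * s))"
    using card_square_trace_ge D0 by (intro mult_left_mono diff_mono) (auto simp: X_def)
  \<comment> \<open>The \<open>+ 1\<close> in the bound is \<open>2 * s\<close> from the
    \<open>- 1\<close> in \<open>2 ^ card P - 1\<close>, less the \<open>s\<close> lost in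
    \<open>card_square_trace_ge\<close>.\<close>
  moreover have "D * (s\<^sup>2 - s - (2 ^ card P - 1) * (2 * s)) = \<theta> m * s * (s - 2 * 2 ^ card P + 1)"
    by (simp add: D power2_eq_square algebra_simps)
  ultimately show ?thesis by (simp add: P_def)
qed

end

end

section \<open>Counting square-free divisors\<close>

lemma finite_squarefree_divisors: "m > 0 \<Longrightarrow> finite {d::nat. d dvd m \<and> squarefree d}"
  by (rule finite_subset[of _ "{..m}"]) (auto dest: dvd_imp_le)

lemma W_mono: "a dvd b \<Longrightarrow> b > 0 \<Longrightarrow> W a \<le> W b"
  unfolding W_def by (intro card_mono finite_squarefree_divisors) (auto intro: dvd_trans)

lemma prime_factors_prod_primes:
  fixes S :: "nat set"
  assumes "finite S" "\<And>p. p \<in> S \<Longrightarrow> prime p"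
  shows "prime_factors (\<Prod>S) = S"
proof -
  have "\<Prod>S \<noteq> 0" using assms by (metis not_prime_0 prod_zero_iff)
  then have "p \<in> prime_factors (\<Prod>S) \<longleftrightarrow> prime p \<and> (\<exists>r\<in>S. p dvd r)" for p
    using assms(1) by (auto simp: in_prime_factors_iff prime_dvd_prod_iff)
  then show ?thesis
    using assms(2) by (metis dvd_refl primes_dvd_imp_eq subsetI subset_antisym)
qed

lemma prod_primes_dvd:
  fixes S :: "nat set"
  assumes "finite S" "\<And>p. p \<in> S \<Longrightarrow> prime p \<and> p dvd m"
  shows "\<Prod>S dvd m"
  using assms
proof (induction S rule: finite_induct)
  case (insert p S)
  have "coprime p (\<Prod>S)"
    using insert by (intro prod_coprime_right) (metis insertI1 insertI2 primes_coprime)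
  then show ?case using insert by (simp add: divides_mult)
qed simp

text \<open>Each set of prime factors of \<open>m\<close> is recovered from its product, so distinct
  sets give distinct square-free divisors. This direction suffices because \<open>W m\<close> enters
  the final bound negatively.\<close>

lemma two_power_card_prime_factors_le_W:
  assumes "m > 0"
  shows "2 ^ card (prime_factors m) \<le> W m"
proof -
  have "inj_on Prod (Pow (prime_factors m))"
  proof (rule inj_on_inverseI[where g = prime_factors])
    fix S assume S: "S \<in> Pow (prime_factors m)"
    then have "finite S" by (auto intro: finite_subset)
    then show "prime_factors (\<Prod>S) = S"
      using S by (intro prime_factors_prod_primes) auto
  qed
  moreover have "Prod ` Pow (prime_factors m) \<subseteq> {d. d dvd m \<and> squarefree d}"
  proof safe
    fix S assume S: "S \<subseteq> prime_factors m"
    then have "finite S" by (auto intro: finite_subset)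
    then show "\<Prod>S dvd m" using S by (intro prod_primes_dvd) auto
    show "squarefree (\<Prod>S)"
      using S by (intro squarefree_prod_coprime) (auto intro: primes_coprime squarefree_prime)
  qed
  ultimately have "card (Pow (prime_factors m)) \<le> W m"
    unfolding W_def by (intro card_inj_on_le finite_squarefree_divisors assms)
  then show ?thesis by (simp add: card_Pow)
qed

theorem theorem5p5:
  fixes K :: "'a::finite_field set" and \<beta> :: 'a
    and q n m Q m\<^sub>Q :: nat
  assumes "primepow q" and "odd q"
    and "n \<ge> 2" and "even ((q ^ n - 1) div 2)"
    and "CARD('a) = q ^ n"
    and "is_subfield K" and "card K = q"
    and "\<beta> \<in> K" and "\<beta> \<noteq> 0"
    and "even m" and "m dvd q ^ n - 1"
    and "Q = (q ^ n - 1) div (q - 1)"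
    and "m\<^sub>Q = \<Prod>{p. prime p \<and> p dvd m \<and> p dvd Q}"
  shows "real (N_count q n \<beta> m) \<ge>
    \<theta> m * real q powr ((real n - 1) / 2) *
      (real q powr ((real n - 1) / 2) - 4 * real (W m) + 2 * real (W m\<^sub>Q) + 1)"
proof -
  obtain g :: 'a where g: "g \<noteq> 0" "\<And>x. x \<noteq> 0 \<Longrightarrow> \<exists>i::nat. x = g ^ i"
    using finite_field_has_generator by blast
  interpret trace_generator g "CARD('a) - 1" K q n
    by unfold_locales (use g assms(1,3,5,6,7) in auto)
  define s where "s = real q powr ((real n - 1) / 2)"
  have s: "s \<ge> 0" "s\<^sup>2 = real q ^ (n - 1)"
  proof -
    have "s\<^sup>2 = real q powr (real (n - 1))"
      using assms(3) by (simp add: s_def power2_eq_square of_nat_diff flip: powr_add)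
    also have "\<dots> = real q ^ (n - 1)" using q_gt_1 by (simp add: powr_realpow)
    finally show "s\<^sup>2 = real q ^ (n - 1)" .
  qed (simp add: s_def)
  have mN: "m dvd CARD('a) - 1" using assms(5,11) by simp
  then have m0: "m > 0" using N_pos by (auto intro: Nat.gr0I)
  have "finite {p. prime p \<and> p dvd m \<and> p dvd Q}"
    by (rule finite_subset[of _ "{..m}"]) (use m0 dvd_imp_le in blast, simp)
  then have "m\<^sub>Q dvd m"
    unfolding assms(13) by (rule prod_primes_dvd) blast
  then have "W m\<^sub>Q \<le> W m" using m0 by (rule W_mono)
  moreover have "2 ^ card (prime_factors m) \<le> real (W m)"
    using of_nat_mono[OF two_power_card_prime_factors_le_W[OF m0], where 'a = real] by simp
  \<comment> \<open>From \<open>W m\<^sub>Q \<le> W m\<close> the two \<open>W\<close> terms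
    together are at most \<open>- 2 * W m\<close>, hence at most
    \<open>- 2 * 2 ^ card (prime_factors m)\<close>.\<close>
  ultimately have "s - 4 * real (W m) + 2 * real (W m\<^sub>Q) + 1 \<le> s - 2 * 2 ^ card (prime_factors m) + 1"
    by linarith
  moreover have "\<theta> m * s \<ge> 0" using s(1) by (simp add: \<theta>_def)
  ultimately have "\<theta> m * s * (s - 4 * real (W m) + 2 * real (W m\<^sub>Q) + 1) \<le>
      \<theta> m * s * (s - 2 * 2 ^ card (prime_factors m) + 1)"
    by (rule mult_left_mono)
  also have "\<dots> \<le> real (N_count q n \<beta> m)"
    by (rule N_count_ge[OF assms(2,8,9) s mN])
  finally show ?thesis unfolding s_def .
qed

end
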